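(* Let $G=(V,E)$ be a connected graph and $(G,\mathcal{F})$ a Gaussian sheaf with orthogonal restriction maps. Then there exist a family $\{\nu_j\}_{j\in J}\subset C^0(G,\mathcal{F})$ and weight matrices $W_\alpha$, $W_\beta$ such that $$V((I\otimes W_\alpha)\#\nu_j)>V(\nu_j)\quad\text{and}\quad V((I\otimes W_\beta)\#\nu_j)<V(\nu_j),$$ where $V(\cdot)$ denotes the Lyapunov energy of $(G,\mathcal{F})$, taken with respect to the 2-Wasserstein distance.
   Context: Graphs are finite, undirected and unweighted. $\mathcal{G}(\mathbb{R}^d)$ is the set of (possibly degenerate) Gaussian distributions $\mathcal{N}(\mu,\Sigma)$ on $\mathbb{R}^d$, identified with pairs $(\mu,\Sigma)$, $\mu\in\mathbb{R}^d$, $\Sigma$ symmetric positive semidefinite. For $A\in\mathbb{R}^{d\times d}$ put $\Phi_A(\mu,\Sigma)=(A\mu,A\Sigma A^\top)$ (the pushforward of the Gaussian by $A$). A Gaussian sheaf $(G,\mathcal{F})$ with stalk dimension $d$ (common to all vertices and edges) assigns the stalk $\mathcal{G}(\mathbb{R}^d)$ to each vertex and each edge, and to each incident vertex–edge pair $v\unlhd e$ a matrix $\mathcal{F}_{v\unlhd e}\in\mathbb{R}^{d\times d}$, acting as the restriction map $\Phi_{\mathcal{F}_{v\unlhd e}}$. Orthogonal restriction maps means all $\mathcal{F}_{v\unlhd e}\in O(d)$. $C^0(G,\mathcal{F})$ is the set of families $\nu=(\nu_v)_{v\in V}$ with $\nu_v\in\mathcal{G}(\mathbb{R}^d)$. Weight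 matrices are matrices $W\in\mathbb{R}^{d\times d}$, and $(I\otimes W)\#\nu$ is the family $(\Phi_W(\nu_v))_{v\in V}$. Let $D_v=\sum_{e:\,v\unlhd e}\mathcal{F}_{v\unlhd e}^\top\mathcal{F}_{v\unlhd e}$. The Lyapunov energy of $\nu\in C^0(G,\mathcal{F})$ is $$V(\nu)=\sum_{e=(v,u)\in E}W_2\Big(\Phi_{\mathcal{F}_{v\unlhd e}D_v^{-1/2}}(\nu_v),\Phi_{\mathcal{F}_{u\unlhd e}D_u^{-1/2}}(\nu_u)\Big)^2,$$ where $W_2$ is the 2-Wasserstein distance; for Gaussians, $W_2(\mathcal{N}(\mu,\Sigma),\mathcal{N}(\mu',\Sigma'))^2=\|\mu-\mu'\|_2^2+\operatorname{tr}\big(\Sigma+\Sigma'-2(\Sigma^{1/2}\Sigma'\Sigma^{1/2})^{1/2}\big)$. (The letter $V$ is used both for the vertex set of $G$ and for the energy.)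
   Formalization: The graph is assumed to have at least one edge and the stalk dimension d to be at least 1; for the one-vertex graph or d = 0 the energy is identically 0, so the strict inequalities fail for every nonempty family. *)

theory Defs
  imports "HOL-Probability.Probability"
begin

definition simple_graph :: "'v set \<Rightarrow> 'v set set \<Rightarrow> bool" where
  "simple_graph V E \<longleftrightarrow> finite V \<and> (\<forall>e\<in>E. e \<subseteq> V \<and> card e = 2)"

definition connected_graph :: "'v set \<Rightarrow> 'v set set \<Rightarrow> bool" where
  "connected_graph V E \<longleftrightarrow>
     V \<noteq> {} \<and> (\<forall>u\<in>V. \<forall>v\<in>V. (u, v) \<in> {(x, y). {x, y} \<in> E}\<^sup>*)"

definition psd_matrix :: "real^'n^'n \<Rightarrow> bool" where
  "psd_matrix S \<longleftrightarrow> transpose S = S \<and> (\<forall>x. 0 \<le> x \<bullet> (S *v x))"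

text \<open>The principal square root; meaningful for positive semidefinite arguments only.\<close>

definition psd_sqrt :: "real^'n^'n \<Rightarrow> real^'n^'n" where
  "psd_sqrt S = (THE B. psd_matrix B \<and> B ** B = S)"

text \<open>A possibly degenerate Gaussian distribution is represented by its mean and its
  covariance matrix; \<open>gaussian_measure\<close> is the probability measure it stands for, namely the
  law of \<open>\<mu> + \<Sigma>\<^sup>1\<^sup>/\<^sup>2 Z\<close> where \<open>Z\<close> has independent standard normal coordinates.\<close>

type_synonym 'n gauss = "(real^'n) \<times> (real^'n^'n)"

definition gaussians :: "'n::finite gauss set" where
  "gaussians = {(\<mu>, S). psd_matrix S}"

definition std_gaussian_measure :: "(real^'n) measure" where
  "std_gaussian_measure =
     distr (Pi\<^sub>M UNIV (\<lambda>_. std_normal_distribution)) borel (\<lambda>z. \<chi> i. z i)"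

definition gaussian_measure :: "'n::finite gauss \<Rightarrow> (real^'n) measure" where
  "gaussian_measure = (\<lambda>(\<mu>, S). distr std_gaussian_measure borel (\<lambda>z. \<mu> + psd_sqrt S *v z))"

definition gauss_push :: "real^'n^'n \<Rightarrow> 'n::finite gauss \<Rightarrow> 'n gauss" where
  "gauss_push A = (\<lambda>(\<mu>, S). (A *v \<mu>, A ** S ** transpose A))"

definition couplings :: "'a measure \<Rightarrow> 'b measure \<Rightarrow> ('a \<times> 'b) measure set" where
  "couplings M N = {P. sets P = sets (M \<Otimes>\<^sub>M N) \<and> distr P M fst = M \<and> distr P N snd = N}"

text \<open>The infimum is taken in the extended nonnegative reals. It is finite whenever both
  measures are probability measures with finite second moments, in particular for Gaussians, so
  that \<open>enn2real\<close> does not affect the value.\<close>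

definition wasserstein2 :: "'a::metric_space measure \<Rightarrow> 'a measure \<Rightarrow> real" where
  "wasserstein2 M N =
     sqrt (enn2real (INF P\<in>couplings M N. \<integral>\<^sup>+ z. ennreal ((dist (fst z) (snd z))\<^sup>2) \<partial>P))"

definition gauss_W2 :: "'n::finite gauss \<Rightarrow> 'n gauss \<Rightarrow> real" where
  "gauss_W2 g h = wasserstein2 (gaussian_measure g) (gaussian_measure h)"

text \<open>All stalks are the Gaussians on \<open>real^'n\<close>, so a Gaussian sheaf on a graph is given by the
  matrices \<open>F v e\<close> of its restriction maps; only the values at incident pairs \<open>v \<in> e\<close> matter.\<close>

type_synonym ('v, 'n) gauss_sheaf = "'v \<Rightarrow> 'v set \<Rightarrow> real^'n^'n"

definition orthogonal_sheaf :: "'v set set \<Rightarrow> ('v, 'n::finite) gauss_sheaf \<Rightarrow> bool" where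
  "orthogonal_sheaf E F \<longleftrightarrow> (\<forall>e\<in>E. \<forall>v\<in>e. orthogonal_matrix (F v e))"

definition cochains :: "'v set \<Rightarrow> ('v \<Rightarrow> 'n::finite gauss) set" where
  "cochains V = V \<rightarrow> gaussians"

text \<open>The action of \<open>I \<otimes> W\<close>.\<close>

definition cochain_push :: "real^'n^'n \<Rightarrow> ('v \<Rightarrow> 'n::finite gauss) \<Rightarrow> 'v \<Rightarrow> 'n gauss" where
  "cochain_push W \<nu> = (\<lambda>v. gauss_push W (\<nu> v))"

definition sheaf_degree :: "'v set set \<Rightarrow> ('v, 'n::finite) gauss_sheaf \<Rightarrow> 'v \<Rightarrow> real^'n^'n" where
  "sheaf_degree E F v = (\<Sum>e\<in>{e\<in>E. v \<in> e}. transpose (F v e) ** F v e)"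

definition normalized_restriction ::
    "'v set set \<Rightarrow> ('v, 'n::finite) gauss_sheaf \<Rightarrow> 'v \<Rightarrow> 'v set \<Rightarrow> real^'n^'n" where
  "normalized_restriction E F v e = F v e ** matrix_inv (psd_sqrt (sheaf_degree E F v))"

definition edge_discrepancy ::
    "'v set set \<Rightarrow> ('v, 'n::finite) gauss_sheaf \<Rightarrow> ('v \<Rightarrow> 'n gauss) \<Rightarrow> 'v set \<Rightarrow> 'v \<Rightarrow> 'v \<Rightarrow> real" where
  "edge_discrepancy E F \<nu> e v u =
     (gauss_W2 (gauss_push (normalized_restriction E F v e) (\<nu> v))
               (gauss_push (normalized_restriction E F u e) (\<nu> u)))\<^sup>2"

text \<open>Every edge contributes once. Which of its two orientations \<open>(v, u)\<close> is used does not matter,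
  since the discrepancy is symmetric; see the lemmas below.\<close>

definition orientation :: "'v set \<Rightarrow> 'v \<times> 'v" where
  "orientation e = (SOME p. e = {fst p, snd p})"

definition lyapunov_energy ::
    "'v set set \<Rightarrow> ('v, 'n::finite) gauss_sheaf \<Rightarrow> ('v \<Rightarrow> 'n gauss) \<Rightarrow> real" where
  "lyapunov_energy E F \<nu> = (\<Sum>e\<in>E. case orientation e of (v, u) \<Rightarrow> edge_discrepancy E F \<nu> e v u)"

lemma sets_gaussian_measure: "sets (gaussian_measure g) = sets borel"
  by (simp add: gaussian_measure_def split: prod.splits)

lemma prob_space_std_gaussian_measure: "prob_space (std_gaussian_measure :: (real^'n::finite) measure)"
proof -
  interpret prob_space "Pi\<^sub>M UNIV (\<lambda>_::'n. std_normal_distribution)"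
    by (intro prob_space_PiM prob_space_normal_density) simp
  have "(\<lambda>z. \<chi> i. z i) \<in> borel_measurable (Pi\<^sub>M UNIV (\<lambda>_::'n. std_normal_distribution))"
  proof (subst borel_measurable_euclidean_space, intro ballI)
    fix b :: "real^'n" assume "b \<in> Basis"
    then obtain i where "b = axis i 1" by (auto simp: Basis_vec_def)
    then have "(\<lambda>z. (\<chi> i. z i) \<bullet> b) = (\<lambda>z. z i)"
      by (simp add: inner_axis)
    moreover have "(\<lambda>z. z i) \<in> Pi\<^sub>M UNIV (\<lambda>_::'n. std_normal_distribution) \<rightarrow>\<^sub>M std_normal_distribution"
      by (rule measurable_component_singleton) simp
    ultimately show "(\<lambda>z. (\<chi> i. z i) \<bullet> b)
        \<in> borel_measurable (Pi\<^sub>M UNIV (\<lambda>_::'n. std_normal_distribution))"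
      by simp
  qed
  then show ?thesis
    unfolding std_gaussian_measure_def by (rule prob_space_distr)
qed

lemma prob_space_gaussian_measure: "prob_space (gaussian_measure g)"
proof (cases g)
  case (Pair \<mu> S)
  interpret prob_space "std_gaussian_measure :: (real^'a) measure"
    by (rule prob_space_std_gaussian_measure)
  have "(\<lambda>z. \<mu> + psd_sqrt S *v z) \<in> borel_measurable std_gaussian_measure"
    by (simp add: std_gaussian_measure_def borel_measurable_continuous_onI continuous_intros)
  then show ?thesis
    unfolding Pair gaussian_measure_def by (simp add: prob_space_distr)
qed

lemma wasserstein2_commute:
  fixes M N :: "'a::{metric_space, second_countable_topology} measure"
  assumes M: "sets M = sets borel" and N: "sets N = sets borel"
  shows "wasserstein2 M N = wasserstein2 N M"
proof -
  have le: "(INF P\<in>couplings B A. \<integral>\<^sup>+ z. ennreal ((dist (fst z) (snd z))\<^sup>2) \<partial>P)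
      \<le> (\<integral>\<^sup>+ z. ennreal ((dist (fst z) (snd z))\<^sup>2) \<partial>P)"
    if A: "sets A = sets borel" and B: "sets B = sets borel" and P: "P \<in> couplings A B"
    for A B :: "'a measure" and P
  proof (rule INF_lower2)
    let ?Q = "distr P (B \<Otimes>\<^sub>M A) (\<lambda>(x, y). (y, x))"
    have sP[measurable_cong]: "sets P = sets (A \<Otimes>\<^sub>M B)"
      and P1: "distr P A fst = A" and P2: "distr P B snd = B"
      using P by (auto simp: couplings_def)
    have [measurable]: "(\<lambda>(x, y). (y, x)) \<in> P \<rightarrow>\<^sub>M B \<Otimes>\<^sub>M A"
      by measurable
    show "?Q \<in> couplings B A"
      using P1 P2 by (simp add: couplings_def distr_distr comp_def split_beta)
    have "sets (B \<Otimes>\<^sub>M A) = sets (borel \<Otimes>\<^sub>M borel)"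
      using A B by (rule sets_pair_measure_cong[rotated])
    then have "(\<lambda>z. ennreal ((dist (fst z) (snd z))\<^sup>2)) \<in> borel_measurable (B \<Otimes>\<^sub>M A)"
      by (subst measurable_cong_sets[OF _ refl]) (assumption, measurable)
    then have "(\<integral>\<^sup>+ z. ennreal ((dist (fst z) (snd z))\<^sup>2) \<partial>?Q)
        = (\<integral>\<^sup>+ z. ennreal ((dist (fst z) (snd z))\<^sup>2) \<partial>P)"
      by (subst nn_integral_distr) (simp_all add: split_beta dist_commute)
    then show "(\<integral>\<^sup>+ z. ennreal ((dist (fst z) (snd z))\<^sup>2) \<partial>?Q)
        \<le> (\<integral>\<^sup>+ z. ennreal ((dist (fst z) (snd z))\<^sup>2) \<partial>P)"
      by simp
  qed
  show ?thesis
    unfolding wasserstein2_def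
    by (intro arg_cong[where f = "\<lambda>x. sqrt (enn2real x)"] antisym INF_greatest)
       (use le M N in blast)+
qed

lemma gauss_W2_commute: "gauss_W2 g h = gauss_W2 h g"
  unfolding gauss_W2_def by (intro wasserstein2_commute sets_gaussian_measure)

lemma edge_discrepancy_commute: "edge_discrepancy E F \<nu> e v u = edge_discrepancy E F \<nu> e u v"
  unfolding edge_discrepancy_def by (subst gauss_W2_commute) (rule refl)

lemma orientation_eq:
  assumes "card e = 2" and "orientation e = (v, u)"
  shows "e = {v, u}"
proof -
  have "\<exists>p. e = {fst p, snd p}"
    using assms(1) by (auto simp: card_2_iff)
  then have "e = {fst (orientation e), snd (orientation e)}"
    unfolding orientation_def by (rule someI_ex)
  then show ?thesis using assms(2) by simp
qed

lemma lyapunov_energy_orientation: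
  assumes "simple_graph V E" and "\<And>e. e \<in> E \<Longrightarrow> e = {s e, t e}"
  shows "lyapunov_energy E F \<nu> = (\<Sum>e\<in>E. edge_discrepancy E F \<nu> e (s e) (t e))"
  unfolding lyapunov_energy_def
proof (rule sum.cong[OF refl])
  fix e assume e: "e \<in> E"
  obtain v u where p: "orientation e = (v, u)" by fastforce
  have "e = {v, u}" using assms(1) e p by (intro orientation_eq) (auto simp: simple_graph_def)
  with assms(2)[OF e] have "v = s e \<and> u = t e \<or> v = t e \<and> u = s e"
    by (metis doubleton_eq_iff)
  then show "(case orientation e of (v, u) \<Rightarrow> edge_discrepancy E F \<nu> e v u)
      = edge_discrepancy E F \<nu> e (s e) (t e)"
    using p edge_discrepancy_commute by fastforce
qed

end

(*
  On point masses the Wasserstein distance is the distance of the means, so the energy is a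
  quadratic form in the means; the weight matrix 2 I multiplies it by 4 and 0 annihilates it.
  It is positive for a point-mass cochain whose mean is nonzero at exactly one end of an edge,
  since the normalized restriction maps are injective.
*)
theory Submission
  imports Defs
begin

lemma mat_mult_vec: "mat c *v x = c *\<^sub>R (x :: real^'n)"
proof -
  have "mat c = c *\<^sub>R (mat 1 :: real^'n^'n)"
    by (simp add: vec_eq_iff mat_def)
  then show ?thesis
    by (simp flip: scaleR_matrix_vector_assoc)
qed

text \<open>\<open>psd_sqrt\<close> is a definite description, so uniqueness of the root is needed
  as well: \<open>B\<close> acts as -sqrt c on the range of \<open>B\<close> - sqrt c I, so for c >
  0 positivity forces that range to be zero. Used for degree matrices and for covariance 0.\<close>

lemma psd_sqrt_mat:
  assumes "c \<ge> 0"
  shows "psd_sqrt (mat c :: real^'n^'n) = mat (sqrt c)"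
  unfolding psd_sqrt_def
proof (rule the_equality)
  show "psd_matrix (mat (sqrt c) :: real^'n^'n) \<and> mat (sqrt c) ** mat (sqrt c) = (mat c :: real^'n^'n)"
    using assms
    by (simp add: psd_matrix_def transpose_mat mat_mult_vec matrix_eq flip: matrix_vector_mul_assoc)
next
  fix B :: "real^'n^'n" assume B: "psd_matrix B \<and> B ** B = mat c"
  then have sym: "transpose B = B" and pos: "0 \<le> x \<bullet> (B *v x)" for x
    by (auto simp: psd_matrix_def)
  have BB: "B *v (B *v x) = c *\<^sub>R x" for x
    using B by (simp add: matrix_vector_mul_assoc mat_mult_vec)
  have "B *v x = sqrt c *\<^sub>R x" for x
  proof (cases "c = 0")
    case True
    \<comment> \<open>Positivity does not exclude the eigenvalue 0. Instead, symmetry moves one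
      \<open>B\<close> across the inner product, and \<open>B ** B\<close> vanishes.\<close>
    have "(B *v x) \<bullet> (B *v x) = x \<bullet> (B *v (B *v x))"
      by (metis sym dot_lmul_matrix matrix_vector_mul_assoc transpose_matrix_vector)
    then show ?thesis using True BB by simp
  next
    case False
    \<comment> \<open>\<open>y\<close> would be an eigenvector for the negative eigenvalue \<open>- sqrt c\<close>.\<close>
    define y where "y = B *v x - sqrt c *\<^sub>R x"
    have "B *v y = - sqrt c *\<^sub>R y"
      using assms BB unfolding y_def
      by (simp add: matrix_vector_mult_diff_distrib matrix_vector_mult_scaleR scaleR_diff_right)
    then have "0 \<le> - sqrt c * (y \<bullet> y)" using pos[of y] by simp
    then have "y \<bullet> y \<le> 0"
      using assms False by (simp add: mult_le_0_iff)
    then have "y = 0" by (metis inner_ge_zero inner_eq_zero_iff order_antisym)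
    then show ?thesis unfolding y_def by simp
  qed
  then show "B = mat (sqrt c)" by (simp add: matrix_eq mat_mult_vec)
qed

lemma psd_sqrt_zero: "psd_sqrt (0 :: real^'n^'n) = 0"
  using psd_sqrt_mat[of 0, where 'n = 'n] by simp

text \<open>The map transporting the standard Gaussian is constant, and the law of a constant under
  a probability measure is a point mass.\<close>

lemma gaussian_measure_zero_cov: "gaussian_measure (\<mu>, 0 :: real^'n^'n) = return borel \<mu>"
proof -
  interpret prob_space "std_gaussian_measure :: (real^'n) measure"
    by (rule prob_space_std_gaussian_measure)
  show ?thesis
    by (simp add: gaussian_measure_def psd_sqrt_zero distr_const)
qed

text \<open>Point-mass marginals make both coordinates constant almost everywhere, so all couplings
  have the same cost and nothing is left to minimize.\<close>

lemma nn_integral_coupling_return: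
  fixes a b :: "'a::{metric_space, second_countable_topology}"
  assumes "P \<in> couplings (return borel a) (return borel b)"
  shows "(\<integral>\<^sup>+ z. ennreal ((dist (fst z) (snd z))\<^sup>2) \<partial>P) = ennreal ((dist a b)\<^sup>2)"
proof -
  have sP: "sets P = sets (borel \<Otimes>\<^sub>M borel)"
    and P1: "distr P (return borel a) fst = return borel a"
    and P2: "distr P (return borel b) snd = return borel b"
    using assms by (auto simp: couplings_def cong: sets_pair_measure_cong)
  have f: "fst \<in> P \<rightarrow>\<^sub>M return borel a" and s: "snd \<in> P \<rightarrow>\<^sub>M return borel b"
    unfolding measurable_cong_sets[OF sP sets_return] by measurable
  have "AE x in distr P (return borel a) fst. x = a"
    unfolding P1 by (subst AE_return) auto
  then have AE1: "AE z in P. fst z = a"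
    using f by (subst (asm) AE_distr_iff) auto
  have "AE x in distr P (return borel b) snd. x = b"
    unfolding P2 by (subst AE_return) auto
  then have AE2: "AE z in P. snd z = b"
    using s by (subst (asm) AE_distr_iff) auto
  \<comment> \<open>\<open>couplings\<close> does not ask for total mass 1; it is inherited from the
    first marginal.\<close>
  have "emeasure P (space P) = emeasure (distr P (return borel a) fst) UNIV"
    using f by (subst emeasure_distr) auto
  then have P: "emeasure P (space P) = 1" by (simp add: P1)
  have "(\<integral>\<^sup>+ z. ennreal ((dist (fst z) (snd z))\<^sup>2) \<partial>P) = (\<integral>\<^sup>+ z. ennreal ((dist a b)\<^sup>2) \<partial>P)"
    by (intro nn_integral_cong_AE) (use AE1 AE2 in eventually_elim, simp)
  then show ?thesis by (simp add: P)
qed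

lemma wasserstein2_return:
  fixes a b :: "'a::{metric_space, second_countable_topology}"
  shows "wasserstein2 (return borel a) (return borel b) = dist a b"
proof -
  let ?C = "couplings (return borel a) (return borel b)"
  \<comment> \<open>This witness only shows that a coupling exists: an infimum over the empty set
    would be infinite, and \<open>enn2real\<close> would turn it into 0.\<close>
  let ?P = "return (return borel a \<Otimes>\<^sub>M return borel b) (a, b)"
  have "distr ?P (return borel a) fst = return (return borel a) a"
    "distr ?P (return borel b) snd = return (return borel b) b"
    by (subst distr_return;
        simp add: space_pair_measure
          measurable_cong_sets[OF sets_pair_measure_cong[OF sets_return sets_return] refl])+
  then have "?P \<in> ?C"
    by (simp add: couplings_def return_cong[of "return borel a" borel for a])
  then have "?C \<noteq> {}" by blast
  then have "(INF P\<in>?C. \<integral>\<^sup>+ z. ennreal ((dist (fst z) (snd z))\<^sup>2) \<partial>P) = ennreal ((dist a b)\<^sup>2)"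
    by (simp add: nn_integral_coupling_return)
  then show ?thesis by (simp add: wasserstein2_def)
qed

lemma gauss_W2_zero_cov: "gauss_W2 (a, 0 :: real^'n^'n) (b, 0) = dist a b"
  by (simp add: gauss_W2_def gaussian_measure_zero_cov wasserstein2_return)

lemma gauss_push_zero_cov: "gauss_push A (\<mu>, 0) = (A *v \<mu>, 0)"
  by (simp add: gauss_push_def)

lemma edge_discrepancy_zero_cov:
  "edge_discrepancy E F (\<lambda>v. (\<mu> v, 0)) e v u =
     (dist (normalized_restriction E F v e *v \<mu> v) (normalized_restriction E F u e *v \<mu> u))\<^sup>2"
  by (simp add: edge_discrepancy_def gauss_push_zero_cov gauss_W2_zero_cov)

lemma dist_scaleR_same: "dist (c *\<^sub>R x) (c *\<^sub>R y) = \<bar>c\<bar> * dist x (y :: 'a::real_normed_vector)"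
  by (simp add: dist_norm flip: scaleR_diff_right)

text \<open>Scalar matrices commute with the restriction maps and preserve covariance 0, so each
  edge distance is multiplied by the absolute value of c.\<close>

lemma lyapunov_energy_push_zero_cov:
  fixes \<mu> :: "'v \<Rightarrow> real^'n"
  shows "lyapunov_energy E F (cochain_push (mat c) (\<lambda>v. (\<mu> v, 0))) =
         c\<^sup>2 * lyapunov_energy E F (\<lambda>v. (\<mu> v, 0))"
  by (auto simp: lyapunov_energy_def cochain_push_def gauss_push_zero_cov edge_discrepancy_zero_cov
      mat_mult_vec matrix_vector_mult_scaleR dist_scaleR_same power_mult_distrib sum_distrib_left
      split: prod.splits intro!: sum.cong)

lemma sheaf_degree_orthogonal:
  assumes "orthogonal_sheaf E F"
  shows "sheaf_degree E F v = mat (real (card {e \<in> E. v \<in> e}))"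
proof -
  have "sheaf_degree E F v = (\<Sum>e\<in>{e \<in> E. v \<in> e}. mat 1)"
    unfolding sheaf_degree_def using assms
    by (intro sum.cong) (auto simp: orthogonal_sheaf_def orthogonal_matrix_def)
  then show ?thesis
    by (simp add: sum_constant_scaleR vec_eq_iff mat_def del: sum_constant)
qed

text \<open>The degree matrix is the number of edges at \<open>v\<close> times the identity, so the
  square root of that number cancels the normalization.\<close>

lemma normalized_restriction_eq:
  assumes "finite E" "orthogonal_sheaf E F" "e \<in> E" "v \<in> e"
  shows "normalized_restriction E F v e *v
     (sqrt (real (card {e \<in> E. v \<in> e})) *\<^sub>R x) = F v e *v x"
proof -
  define r where "r = sqrt (real (card {e \<in> E. v \<in> e}))"
  have "{e \<in> E. v \<in> e} \<noteq> {}" "finite {e \<in> E. v \<in> e}" using assms by auto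
  then have "r > 0" unfolding r_def by (simp add: card_gt_0_iff)
  then have "mat r ** mat (1/r) = (mat 1 :: real^'b^'b) \<and> mat (1/r) ** mat r = (mat 1 :: real^'b^'b)"
    by (simp add: matrix_eq mat_mult_vec flip: matrix_vector_mul_assoc)
  \<comment> \<open>\<open>matrix_inv\<close> is a choice operator; the inverse just exhibited
    guarantees that the chosen matrix is one too.\<close>
  then have "matrix_inv (mat r) ** mat r = (mat 1 :: real^'b^'b)"
    unfolding matrix_inv_def by (metis (mono_tags, lifting) someI_ex)
  then have "matrix_inv (mat r) *v (r *\<^sub>R x) = x"
    by (metis mat_mult_vec matrix_vector_mul_assoc matrix_vector_mul_lid)
  then show ?thesis
    using assms(2)
    by (simp add: normalized_restriction_def sheaf_degree_orthogonal psd_sqrt_mat r_def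
        flip: matrix_vector_mul_assoc)
qed

text \<open>A single vertex is connected but has no edges, and its energy is identically 0;
  \<open>E \<noteq> {}\<close> excludes this case. \<open>J \<noteq> {}\<close> rules out a vacuous
  family.\<close>

theorem propositionA1:
  fixes V :: "'v set" and E :: "'v set set" and F :: "('v, 'n::finite) gauss_sheaf"
  assumes graph: "simple_graph V E"
    and connected: "connected_graph V E"
    and nontrivial: "E \<noteq> {}"
    and orthogonal: "orthogonal_sheaf E F"
  shows "\<exists>(J :: nat set) (\<nu> :: nat \<Rightarrow> 'v \<Rightarrow> 'n gauss)
            (W\<^sub>\<alpha> :: real^'n^'n) (W\<^sub>\<beta> :: real^'n^'n).
           J \<noteq> {} \<and> (\<forall>j\<in>J. \<nu> j \<in> cochains V) \<and>
           (\<forall>j\<in>J. lyapunov_energy E F (cochain_push W\<^sub>\<alpha> (\<nu> j)) > lyapunov_energy E F (\<nu> j) \<and>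
                  lyapunov_energy E F (cochain_push W\<^sub>\<beta> (\<nu> j)) < lyapunov_energy E F (\<nu> j))"
proof -
  have "E \<subseteq> Pow V" "finite V" using graph by (auto simp: simple_graph_def)
  then have fin: "finite E" by (metis finite_Pow_iff finite_subset)
  obtain e where e: "e \<in> E" using nontrivial by blast
  obtain a b where ab: "orientation e = (a, b)" by fastforce
  have card: "card e = 2" using graph e by (simp add: simple_graph_def)
  then have e_eq: "e = {a, b}" using ab by (rule orientation_eq)
  with card have "a \<noteq> b" by auto
  \<comment> \<open>The all-ones vector; any nonzero vector would do.\<close>
  define x :: "real^'n" where "x = 1"
  \<comment> \<open>Supported at \<open>a\<close> alone, so that the edge \<open>e\<close> compares
    \<open>F a e *v x\<close> with 0; the factor cancels the normalization at
    \<open>a\<close>.\<close>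
  define \<mu> where "\<mu> v = (if v = a then sqrt (real (card {e \<in> E. v \<in> e})) *\<^sub>R x else 0)" for v
  define \<nu> :: "'v \<Rightarrow> 'n gauss" where "\<nu> v = (\<mu> v, 0)" for v
  have "transpose (F a e) ** F a e = mat 1"
    using orthogonal e e_eq by (simp add: orthogonal_sheaf_def orthogonal_matrix_def)
  then have "F a e *v x \<noteq> 0"
    by (metis matrix_vector_mul_assoc matrix_vector_mul_lid matrix_vector_mult_0_right x_def zero_neq_one)
  then have "edge_discrepancy E F \<nu> e a b > 0"
    using \<open>a \<noteq> b\<close> normalized_restriction_eq[OF fin orthogonal e, of a x] e_eq
    unfolding \<nu>_def edge_discrepancy_zero_cov by (simp add: \<mu>_def)
  \<comment> \<open>The other edges contribute squares, so one positive term is enough.\<close>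
  then have pos: "lyapunov_energy E F \<nu> > 0"
    unfolding lyapunov_energy_def using fin e ab
    by (intro sum_pos2[of _ e]) (auto simp: edge_discrepancy_def split: prod.splits)
  have scale: "lyapunov_energy E F (cochain_push (mat c) \<nu>) = c\<^sup>2 * lyapunov_energy E F \<nu>" for c
    unfolding \<nu>_def by (rule lyapunov_energy_push_zero_cov)
  have cochain: "\<nu> \<in> cochains V"
    by (simp add: \<nu>_def cochains_def gaussians_def psd_matrix_def transpose_def Pi_def vec_eq_iff)
  show ?thesis
    by (rule exI[of _ "{0}"], rule exI[of _ "\<lambda>_. \<nu>"], rule exI[of _ "mat 2"], rule exI[of _ "mat 0"])
      (use cochain pos in \<open>simp add: scale scale[of 0, simplified]\<close>)
qed

end
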